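(* For all real $x>0$, complex $\beta,r$ with $\operatorname{Re}(\beta)>0$ and $\operatorname{Re}(r)>0$, integers $n=0,1,2,\ldots$ and real $a>n+1$, $$\frac{e^{-rx}}{1-e^{-\beta x}}\,w_{n}\left(\frac{e^{-\beta x}}{1-e^{-\beta x}};0,\beta,r\right)=\frac{\beta^{n}}{2\pi i}\int_{a-i\infty}^{a+i\infty}(\beta x)^{-t}\,\zeta\left(t-n,\frac{r}{\beta}\right)\Gamma(t)\,dt.$$
   Context: Complex powers use the principal branch, and $\zeta(s,c)=\sum_{k\ge0}(k+c)^{-s}$ ($\operatorname{Re}s>1$) is the Hurwitz zeta function. The polynomials are $$w_{n}(x;0,\beta,r)=\sum_{k=0}^{n}W_{\beta,r}(n,k)\,\beta^{k}k!\,x^{k},$$ where the $r$-Whitney numbers of the second kind $W_{\beta,r}(n,k)$ are defined by the formal power series identity $$\left(\frac{e^{\beta t}-1}{\beta}\right)^{k}e^{rt}=k!\sum_{n=0}^{\infty}W_{\beta,r}(n,k)\frac{t^{n}}{n!}.$$ *)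

theory Defs
  imports "HOL-Analysis.Analysis" "HOL-Computational_Algebra.Formal_Power_Series"
begin

definition r_whitney2 :: "complex \<Rightarrow> complex \<Rightarrow> nat \<Rightarrow> nat \<Rightarrow> complex" where
  "r_whitney2 \<beta> r n k =
     fact n / fact k * fps_nth (((fps_exp \<beta> - 1) / fps_const \<beta>) ^ k * fps_exp r) n"

lemma r_whitney2_generating_function:
  "((fps_exp \<beta> - 1) / fps_const \<beta>) ^ k * fps_exp r =
     fps_const (fact k) * Abs_fps (\<lambda>n. r_whitney2 \<beta> r n k / fact n)"
  by (rule fps_ext) (simp add: r_whitney2_def)

text \<open>The polynomials \<open>w\<^sub>n(x; \<alpha>, \<beta>, r)\<close> for \<open>\<alpha> = 0\<close>.\<close>
definition w_poly0 :: "nat \<Rightarrow> complex \<Rightarrow> complex \<Rightarrow> complex \<Rightarrow> complex" where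
  "w_poly0 n \<beta> r x = (\<Sum>k\<le>n. r_whitney2 \<beta> r n k * \<beta> ^ k * fact k * x ^ k)"

text \<open>Only meaningful for \<open>Re s > 1\<close> and \<open>c\<close> not a nonpositive integer:
  \<^const>\<open>suminf\<close> does no analytic continuation, and \<open>0 powr (- s) = 0\<close>.\<close>
definition hurwitz_zeta :: "complex \<Rightarrow> complex \<Rightarrow> complex" where
  "hurwitz_zeta s c = (\<Sum>k. (of_nat k + c) powr (- s))"

text \<open>Integration along the upward line \<open>Re t = a\<close>, parametrised as \<open>t = a + \<i>y\<close>, \<open>dt = \<i> dy\<close>.
  For the Henstock--Kurzweil integral, integrability on \<^term>\<open>UNIV :: real set\<close> includes
  convergence of the improper integral at both ends.\<close>
definition vertical_integrable :: "real \<Rightarrow> (complex \<Rightarrow> complex) \<Rightarrow> bool" where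
  "vertical_integrable a f \<longleftrightarrow> (\<lambda>y. f (Complex a y) * \<i>) integrable_on UNIV"

definition vertical_integral :: "real \<Rightarrow> (complex \<Rightarrow> complex) \<Rightarrow> complex" where
  "vertical_integral a f = integral UNIV (\<lambda>y. f (Complex a y) * \<i>)"

end

theory Submission
  imports Defs "HOL-Probability.Probability" "HOL-Real_Asymp.Real_Asymp"
begin

text \<open>For \<open>Re w > 0\<close>, substituting \<open>u = exp v\<close> in Euler's integral gives
  \<open>w powr (-t) * Gamma t = \<integral> exp (t v - w exp v) dv\<close>: by the binomial series when \<open>\<bar>1 - w\<bar> < 1\<close>,
  and in general because scaling by a small positive number moves \<open>w\<close> into this disc. Read on a
  vertical line, this is a Fourier transform. The formula shows that \<open>Gamma\<close> decays there at least like
  \<open>exp (- \<phi> \<bar>y\<bar>)\<close> for every \<open>\<phi> < \<pi>/2\<close>, and Fourier inversion yields the Cahen--Mellin formula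
  \<open>\<integral> w powr (-t) * Gamma t dy = 2 \<pi> exp (-w)\<close>. Applying it to \<open>w = x (r + \<beta> k)\<close> and summing over \<open>k\<close>
  turns the integral into \<open>\<Sum>k. (r + \<beta> k)^n exp (- x (r + \<beta> k))\<close>, whose exponential generating
  function in \<open>n\<close> is \<open>exp (r t - r x) / (1 - exp (\<beta> t - \<beta> x))\<close>, as for the left-hand side.\<close>

section \<open>Mellin transform of the exponential in the right half-plane\<close>

lemma Gamma_integral_exp:
  fixes t :: complex
  assumes t: "Re t > 0"
  shows "integrable lborel (\<lambda>v::real. exp (t * of_real v - of_real (exp v)))"
    and "(\<integral>v. exp (t * of_real v - of_real (exp v)) \<partial>lborel) = Gamma t"
proof -
  let ?F = "\<lambda>u::real. of_real u powr (t - 1) / of_real (exp u) :: complex"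
  let ?G = "\<lambda>v::real. exp (t * of_real v - of_real (exp v)) :: complex"
  have img: "exp ` (UNIV :: real set) = {0<..}"
    by (auto simp: image_iff intro!: exI[of _ "ln _"] exp_ln[symmetric])
  have eq: "\<bar>exp v\<bar> *\<^sub>R ?F (exp v) = ?G v" for v :: real
  proof -
    have "of_real (exp v) powr (t - 1) = exp ((t - 1) * complex_of_real v)"
      by (simp add: powr_def Ln_of_real flip: exp_of_real)
    then show ?thesis
      by (simp add: scaleR_conv_of_real exp_diff algebra_simps flip: exp_of_real)
  qed
  have "?F absolutely_integrable_on {0<..} \<and> integral {0<..} ?F = Gamma t"
    using absolutely_integrable_Gamma_integral'[OF t] Gamma_integral_complex'[OF t] by auto
  then have "(\<lambda>v. \<bar>exp v\<bar> *\<^sub>R ?F (exp v)) absolutely_integrable_on UNIV \<and>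
      integral UNIV (\<lambda>v. \<bar>exp v\<bar> *\<^sub>R ?F (exp v)) = Gamma t"
    by (subst has_absolute_integral_change_of_variables_real)
       (auto simp: img intro!: derivative_eq_intros inj_onI)
  then have G: "?G absolutely_integrable_on UNIV" "integral UNIV ?G = Gamma t"
    unfolding eq by auto
  \<comment> \<open>Absolute integrability refers to the completed measure; Borel measurability
    brings it back to \<open>lborel\<close>.\<close>
  have "?G \<in> borel_measurable lborel" by measurable
  then show int: "integrable lborel ?G"
    using G(1) by (simp add: set_integrable_def integrable_completion)
  show "(\<integral>v. ?G v \<partial>lborel) = Gamma t"
    using integral_lborel[OF int] G(2) by simp
qed

lemma Gamma_integral_exp_real:
  fixes a :: real
  assumes a: "a > 0"
  shows "integrable lborel (\<lambda>v::real. exp (a * v - exp v))"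
    and "(\<integral>v. exp (a * v - exp v) \<partial>lborel) = Gamma a"
proof -
  have eq: "exp (complex_of_real a * of_real v - of_real (exp v)) = of_real (exp (a * v - exp v))" for v
    by (simp flip: exp_of_real)
  show "integrable lborel (\<lambda>v::real. exp (a * v - exp v))"
    using Gamma_integral_exp(1)[of "of_real a"] a unfolding eq complex_of_real_integrable_eq by simp
  have "complex_of_real (\<integral>v. exp (a * v - exp v) \<partial>lborel) = of_real (Gamma a)"
    using Gamma_integral_exp(2)[of "of_real a"] a unfolding eq by (simp add: Gamma_complex_of_real)
  then show "(\<integral>v. exp (a * v - exp v) \<partial>lborel) = Gamma a"
    by (simp only: of_real_eq_iff)
qed

text \<open>Matches the termwise integrals below with a binomial series: the signs cancel into
  \<open>pochhammer t k\<close>, which raises the argument of \<open>Gamma\<close> by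
  \<open>k\<close>. The type is generic because values are taken over the complex numbers and norms
  over the reals.\<close>

lemma gbinomial_power_Gamma:
  fixes t z :: "'a::Gamma"
  assumes "t \<notin> \<int>\<^sub>\<le>\<^sub>0"
  shows "((- t) gchoose k) * (- z) ^ k * Gamma t = z ^ k / fact k * Gamma (t + of_nat k)"
proof -
  have "pochhammer t k * Gamma t = Gamma (t + of_nat k)"
    using assms by (simp add: pochhammer_Gamma Gamma_eq_zero_iff)
  then have "((- t) gchoose k) * (- z) ^ k * Gamma t = ((-1) * (- z)) ^ k / fact k * Gamma (t + of_nat k)"
    unfolding gbinomial_pochhammer power_mult_distrib by (simp add: mult_ac)
  then show ?thesis by simp
qed

text \<open>Split \<open>exp (- w * exp v)\<close> into \<open>exp (- exp v)\<close> times
  \<open>exp ((1 - w) * exp v)\<close>, expand the second factor and integrate termwise; the results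
  form the binomial series of \<open>w powr (- t)\<close>.\<close>

lemma Mellin_exp_near_1:
  fixes t w :: complex
  assumes t: "Re t > 0" and w: "norm (1 - w) < 1"
  shows "integrable lborel (\<lambda>v::real. exp (t * of_real v - w * of_real (exp v)))"
    and "(\<integral>v. exp (t * of_real v - w * of_real (exp v)) \<partial>lborel) = w powr (- t) * Gamma t"
proof -
  define a where "a = Re t"
  define \<rho> where "\<rho> = norm (1 - w)"
  have a: "a > 0" using t by (simp add: a_def)
  have tn: "t \<notin> \<int>\<^sub>\<le>\<^sub>0" and an: "a \<notin> \<int>\<^sub>\<le>\<^sub>0"
    using t a by (auto elim!: nonpos_Ints_cases)
  define f where "f = (\<lambda>k (v::real). (1 - w) ^ k / fact k *
      exp ((t + of_nat k) * of_real v - of_real (exp v)))"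
  have norm_f: "norm (f k v) = \<rho> ^ k / fact k * exp ((a + real k) * v - exp v)" for k v
    by (simp add: f_def norm_mult norm_divide norm_power a_def \<rho>_def)
  have f_sums: "(\<lambda>k. f k v) sums exp (t * of_real v - w * of_real (exp v))" for v
  proof -
    have eq: "f k v = exp (t * of_real v - of_real (exp v)) *
        (((1 - w) * of_real (exp v)) ^ k /\<^sub>R fact k)" for k
      by (simp add: f_def exp_diff exp_add distrib_right power_mult_distrib scaleR_conv_of_real
          divide_simps exp_of_nat_mult flip: exp_of_real)
    have "(\<lambda>k. f k v) sums (exp (t * of_real v - of_real (exp v)) * exp ((1 - w) * of_real (exp v)))"
      unfolding eq by (intro sums_mult exp_converges)
    then show ?thesis
      by (simp add: algebra_simps flip: exp_add)
  qed
  have int: "integrable lborel (f k)" for k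
    unfolding f_def using t by (intro integrable_mult_right Gamma_integral_exp(1)) auto
  have If: "(\<integral>v. f k v \<partial>lborel) = ((- t) gchoose k) * (w - 1) ^ k * Gamma t" for k
    using gbinomial_power_Gamma[OF tn, of k "1 - w"] t
    by (simp add: f_def Gamma_integral_exp(2))
  have Inf: "(\<integral>v. norm (f k v) \<partial>lborel) = ((- a) gchoose k) * (- \<rho>) ^ k * Gamma a" for k
    unfolding norm_f using gbinomial_power_Gamma[OF an, of k \<rho>] a
    by (simp add: Gamma_integral_exp_real(2))
  have sum1: "AE v in lborel. summable (\<lambda>k. norm (f k v))"
  proof (rule AE_I2)
    fix v
    have eq: "norm (f k v) = exp (a * v - exp v) * ((\<rho> * exp v) ^ k /\<^sub>R fact k)" for k
      by (simp add: norm_f exp_diff exp_add distrib_right power_mult_distrib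
          divide_simps exp_of_nat_mult)
    show "summable (\<lambda>k. norm (f k v))"
      unfolding eq by (intro summable_mult summable_exp_generic)
  qed
  \<comment> \<open>The integrals of the norms are the terms of the real binomial series of
    \<open>(1 - \<rho>) powr (- a)\<close>, times \<open>Gamma a\<close>.\<close>
  have sum2: "summable (\<lambda>k. \<integral>v. norm (f k v) \<partial>lborel)"
    unfolding Inf using w sums_summable[OF gen_binomial_real[of "-\<rho>" "-a"]]
    by (intro summable_mult2) (auto simp: \<rho>_def)
  have suminf_f: "(\<lambda>v. \<Sum>k. f k v) = (\<lambda>v. exp (t * of_real v - w * of_real (exp v)))"
    using f_sums by (auto simp: sums_iff)
  show "integrable lborel (\<lambda>v::real. exp (t * of_real v - w * of_real (exp v)))"
    using integrable_suminf[OF int sum1 sum2] unfolding suminf_f .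
  have "(\<lambda>k. \<integral>v. f k v \<partial>lborel) sums (\<integral>v. exp (t * of_real v - w * of_real (exp v)) \<partial>lborel)"
    using sums_integral[OF int sum1 sum2] unfolding suminf_f .
  moreover have "(\<lambda>k. \<integral>v. f k v \<partial>lborel) sums (w powr (- t) * Gamma t)"
    unfolding If using gen_binomial_complex[of "w - 1" "- t"] w
    by (intro sums_mult2) (auto simp: norm_minus_commute)
  ultimately show "(\<integral>v. exp (t * of_real v - w * of_real (exp v)) \<partial>lborel) = w powr (- t) * Gamma t"
    by (rule sums_unique2)
qed

lemma Mellin_exp:
  fixes t w :: complex
  assumes t: "Re t > 0" and w: "Re w > 0"
  shows "integrable lborel (\<lambda>v::real. exp (t * of_real v - w * of_real (exp v)))"
    and "(\<integral>v. exp (t * of_real v - w * of_real (exp v)) \<partial>lborel) = w powr (- t) * Gamma t"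
proof -
  \<comment> \<open>This \<open>c\<close> minimises the distance of \<open>c * w\<close> from
    1.\<close>
  define c where "c = Re w / (norm w)\<^sup>2"
  have w0: "w \<noteq> 0" using w by auto
  then have c: "c > 0" using w by (simp add: c_def)
  have "(norm (1 - of_real c * w))\<^sup>2 = 1 - 2 * c * Re w + c\<^sup>2 * (norm w)\<^sup>2"
    unfolding cmod_power2 by (simp add: power2_eq_square algebra_simps)
  also have "\<dots> = 1 - c * Re w"
    using w0 by (simp add: c_def power2_eq_square field_simps)
  also have "\<dots> < 1" using c w by simp
  finally have 1: "norm (1 - of_real c * w) < 1"
    by (simp add: abs_square_less_1)
  let ?f = "\<lambda>v::real. exp (t * of_real v - w * of_real (exp v))"
  \<comment> \<open>Translating \<open>v\<close> by \<open>ln c\<close> multiplies \<open>w\<close>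
    by \<open>c\<close>.\<close>
  have shift: "?f (ln c + 1 * v) = of_real c powr t * exp (t * of_real v - of_real c * w * of_real (exp v))" for v
    using c by (simp add: powr_def Ln_of_real exp_add exp_diff algebra_simps)
  have "integrable lborel (\<lambda>v. ?f (ln c + 1 * v))"
    unfolding shift by (intro integrable_mult_right Mellin_exp_near_1 t 1)
  then show "integrable lborel ?f"
    by (subst (asm) lborel_integrable_real_affine_iff) auto
  have "(\<integral>v. ?f v \<partial>lborel) = (\<integral>v. ?f (ln c + 1 * v) \<partial>lborel)"
    by (subst lborel_integral_real_affine[where c = 1 and t = "ln c"]) auto
  also have "\<dots> = of_real c powr t * ((of_real c * w) powr (- t) * Gamma t)"
    unfolding shift using Mellin_exp_near_1(2)[OF t 1] by simp
  also have "(of_real c * w) powr (- t) = of_real c powr (- t) * w powr (- t)"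
    using c by (intro powr_times_real_left) auto
  also have "of_real c powr t * (of_real c powr (- t) * w powr (- t) * Gamma t) = w powr (- t) * Gamma t"
    using c by (simp add: powr_minus field_simps)
  finally show "(\<integral>v. ?f v \<partial>lborel) = w powr (- t) * Gamma t" .
qed

section \<open>Bounds for \<open>Gamma\<close> and complex powers on vertical lines\<close>

lemma integrable_exp_neg_abs:
  fixes \<kappa> :: real
  assumes \<kappa>: "\<kappa> > 0"
  shows "integrable lborel (\<lambda>y. exp (- \<kappa> * \<bar>y\<bar>))"
proof (rule Bochner_Integration.integrable_bound)
  \<comment> \<open>Chosen so that \<open>m * (1 + y\<^sup>2)\<close> stays below the quadratic
    Taylor polynomial of \<open>exp (\<kappa> * \<bar>y\<bar>)\<close>.\<close>
  define m where "m = min 1 (\<kappa>\<^sup>2 / 2)"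
  have m: "m > 0" using \<kappa> by (simp add: m_def)
  show "integrable lborel (\<lambda>y::real. inverse m * inverse (1 + y\<^sup>2))"
    using integrable_inverse_1_plus_square by (simp add: set_integrable_def)
  show "AE y in lborel. norm (exp (- \<kappa> * \<bar>y\<bar>)) \<le> norm (inverse m * inverse (1 + y\<^sup>2))"
  proof (rule AE_I2)
    fix y :: real
    have "m * (1 + y\<^sup>2) \<le> 1 + \<kappa>\<^sup>2 / 2 * y\<^sup>2"
      unfolding distrib_left by (intro add_mono mult_right_mono) (auto simp: m_def)
    also have "\<dots> \<le> 1 + \<kappa> * \<bar>y\<bar> + (\<kappa> * \<bar>y\<bar>)\<^sup>2 / 2"
      using \<kappa> by (simp add: power_mult_distrib)
    also have "\<dots> \<le> exp (\<kappa> * \<bar>y\<bar>)"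
      using \<kappa> by (intro exp_lower_Taylor_quadratic) simp
    finally have "inverse (exp (\<kappa> * \<bar>y\<bar>)) \<le> inverse (m * (1 + y\<^sup>2))"
      using m by (intro le_imp_inverse_le) (auto intro!: mult_pos_pos add_pos_nonneg)
    then show "norm (exp (- \<kappa> * \<bar>y\<bar>)) \<le> norm (inverse m * inverse (1 + y\<^sup>2))"
      using m by (simp add: exp_minus)
  qed
qed auto

text \<open>Rotating the ray of integration by the angle \<open>\<phi>\<close> in the direction given by the sign
  of \<open>y\<close> gains the exponential factor.\<close>
lemma Gamma_vertical_decay:
  fixes a \<phi> :: real
  assumes a: "a > 0" and \<phi>: "0 \<le> \<phi>" "\<phi> < pi / 2"
  obtains C where "\<And>y. norm (Gamma (Complex a y)) \<le> C * exp (- \<phi> * \<bar>y\<bar>)"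
proof
  fix y :: real
  define \<psi> where "\<psi> = (if y \<ge> 0 then \<phi> else - \<phi>)"
  define t where "t = Complex a y"
  have \<psi>: "y * \<psi> = \<phi> * \<bar>y\<bar>" "cos \<psi> = cos \<phi>" by (auto simp: \<psi>_def)
  have cos: "Re (cis \<psi>) > 0" using \<phi> by (auto simp: \<psi> intro!: cos_gt_zero_pi)
  have Arg: "Arg (cis \<psi>) = \<psi>" using \<phi> by (intro Arg_cis) (auto simp: \<psi>_def)
  have "exp (\<phi> * \<bar>y\<bar>) * norm (Gamma t) = norm (cis \<psi> powr (- t) * Gamma t)"
    by (simp add: norm_mult norm_powr_complex Arg t_def \<psi>)
  also have "\<dots> = norm (\<integral>v. exp (t * of_real v - cis \<psi> * of_real (exp v)) \<partial>lborel)"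
    using a cos by (subst Mellin_exp) (auto simp: t_def)
  also have "\<dots> \<le> (\<integral>v. norm (exp (t * of_real v - cis \<psi> * of_real (exp v))) \<partial>lborel)"
    by (rule integral_norm_bound)
  \<comment> \<open>The norm only sees \<open>Re (cis \<psi>) = cos \<phi>\<close>, so this integral
    does not depend on \<open>y\<close> and serves as \<open>C\<close>.\<close>
  also have "\<dots> = (\<integral>v. exp (a * v - cos \<phi> * exp v) \<partial>lborel)"
    by (simp add: t_def \<psi>)
  finally show "norm (Gamma (Complex a y)) \<le> (\<integral>v. exp (a * v - cos \<phi> * exp v) \<partial>lborel) * exp (- \<phi> * \<bar>y\<bar>)"
    by (simp add: t_def exp_minus field_simps)
qed

lemma abs_Arg_le_arccos:
  assumes "w \<noteq> 0" "\<delta> * norm w \<le> Re w" "0 \<le> \<delta>"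
  shows "\<bar>Arg w\<bar> \<le> arccos \<delta>"
proof -
  have "\<delta> \<le> cos \<bar>Arg w\<bar>"
    using assms by (simp add: cos_Arg field_simps)
  then have "arccos (cos \<bar>Arg w\<bar>) \<le> arccos \<delta>"
    using assms by (intro arccos_le_arccos) auto
  then show ?thesis
    using Arg_bounded[of w] by (subst (asm) arccos_cos) auto
qed

text \<open>On the cone the argument of \<open>w\<close> is at most some \<open>\<theta>\<close>
  below pi/2, so the power grows at most like \<open>exp (\<theta> * \<bar>y\<bar>)\<close> and the
  decay of \<open>Gamma\<close> wins. One \<open>h\<close> serves the whole cone, as needed for
  summing over \<open>k\<close> later.\<close>

lemma powr_Gamma_vertical_bound:
  fixes a \<delta> :: real
  assumes a: "a > 0" and \<delta>: "\<delta> > 0"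
  obtains h :: "real \<Rightarrow> real" where "integrable lborel h"
    and "\<And>w y. w \<noteq> 0 \<Longrightarrow> \<delta> * norm w \<le> Re w \<Longrightarrow>
          norm (w powr (- Complex a y) * Gamma (Complex a y)) \<le> norm w powr (- a) * h y"
proof -
  \<comment> \<open>Capping at 1 keeps \<open>arccos\<close> in its domain. The midpoint
    \<open>\<phi>\<close> lies below pi/2, so \<open>Gamma\<close> decays at that rate, and above
    \<open>\<theta>\<close>, so some decay is left over.\<close>
  define \<theta> where "\<theta> = arccos (min 1 \<delta>)"
  define \<phi> where "\<phi> = (\<theta> + pi / 2) / 2"
  have "\<theta> < pi / 2" "\<theta> \<ge> 0"
    using arccos_less_arccos[of 0 "min 1 \<delta>"] \<delta> by (auto simp: \<theta>_def intro!: arccos_lbound)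
  then have \<phi>: "0 \<le> \<phi>" "\<phi> < pi / 2" "\<phi> - \<theta> > 0"
    by (auto simp: \<phi>_def)
  obtain C where C: "\<And>y. norm (Gamma (Complex a y)) \<le> C * exp (- \<phi> * \<bar>y\<bar>)"
    using Gamma_vertical_decay[OF a \<phi>(1,2)] by blast
  show ?thesis
  proof
    show "integrable lborel (\<lambda>y. C * exp (- (\<phi> - \<theta>) * \<bar>y\<bar>))"
      by (intro integrable_mult_right integrable_exp_neg_abs \<phi>)
    fix w :: complex and y :: real
    assume w: "w \<noteq> 0" "\<delta> * norm w \<le> Re w"
    have "min 1 \<delta> * norm w \<le> \<delta> * norm w" by (intro mult_right_mono) auto
    with w(2) have "min 1 \<delta> * norm w \<le> Re w" by linarith
    then have "\<bar>Arg w\<bar> \<le> \<theta>"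
      unfolding \<theta>_def using w \<delta> by (intro abs_Arg_le_arccos) auto
    then have "y * Arg w \<le> \<theta> * \<bar>y\<bar>"
      using abs_ge_self[of "y * Arg w"] mult_right_mono[of "\<bar>Arg w\<bar>" \<theta> "\<bar>y\<bar>"]
      by (simp add: abs_mult mult.commute)
    then have "norm (w powr (- Complex a y)) \<le> norm w powr (- a) * exp (\<theta> * \<bar>y\<bar>)"
      by (simp add: norm_powr_complex mult_left_mono)
    then have "norm (w powr (- Complex a y) * Gamma (Complex a y)) \<le>
        (norm w powr (- a) * exp (\<theta> * \<bar>y\<bar>)) * (C * exp (- \<phi> * \<bar>y\<bar>))"
      unfolding norm_mult by (intro mult_mono C) auto
    also have "\<dots> = norm w powr (- a) * (C * exp (- (\<phi> - \<theta>) * \<bar>y\<bar>))"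
      by (simp add: left_diff_distrib exp_diff exp_minus field_simps)
    finally show "norm (w powr (- Complex a y) * Gamma (Complex a y)) \<le>
        norm w powr (- a) * (C * exp (- (\<phi> - \<theta>) * \<bar>y\<bar>))" .
  qed
qed

lemma measurable_powr_Gamma_vertical:
  fixes a :: real
  assumes "a > 0"
  shows "(\<lambda>y. w powr (- Complex a y) * Gamma (Complex a y)) \<in> borel_measurable lborel"
proof -
  have "continuous_on UNIV (\<lambda>y. w powr (- Complex a y) * Gamma (Complex a y))"
  proof (cases "w = 0")
    case False
    have eq: "Complex a y = of_real a + \<i> * of_real y" for y by (simp add: complex_eq_iff)
    have *: "of_real a + \<i> * of_real y \<notin> \<int>\<^sub>\<le>\<^sub>0" for y
      using assms by (auto elim!: nonpos_Ints_cases simp: complex_eq_iff)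
    show ?thesis
      using * False unfolding powr_def eq
      by (auto intro!: continuous_at_imp_continuous_on continuous_intros isCont_Gamma)
  qed auto
  then show ?thesis by (simp add: borel_measurable_continuous_onI)
qed

section \<open>Fourier inversion and the Cahen-Mellin formula\<close>

text \<open>Pairing \<open>f\<close> with the Gaussian of width \<open>1/c\<close> and its transform with the Gaussian of
  width \<open>c\<close> turns inversion into two dominated limits as \<open>c\<close> tends to infinity.\<close>
lemma Fourier_inversion_at_0:
  fixes f :: "real \<Rightarrow> complex"
  defines "g \<equiv> \<lambda>y. \<integral>v. iexp (y * v) * f v \<partial>lborel"
  assumes f: "integrable lborel f" and cont: "isCont f 0" and bdd: "\<And>v. norm (f v) \<le> B"
    and g: "integrable lborel g"
  shows "(\<integral>y. g y \<partial>lborel) = 2 * of_real pi * f 0"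
proof -
  let ?N = std_normal_density
  have [measurable]: "f \<in> borel_measurable lborel" "g \<in> borel_measurable lborel"
    using f g by auto
  \<comment> \<open>Fubini moves the transform from \<open>f\<close> to the Gaussian, whose
    characteristic function is again Gaussian.\<close>
  have swap: "(\<integral>s. of_real (?N s) * g (c * s) \<partial>lborel) =
      (\<integral>v. f v * of_real (exp (- (c * v)\<^sup>2 / 2)) \<partial>lborel)" for c
  proof -
    define F where "F = (\<lambda>s v. of_real (?N s) * (iexp (c * s * v) * f v))"
    have "integrable (lborel \<Otimes>\<^sub>M lborel) (case_prod F)"
    proof (rule lborel_pair.Fubini_integrable)
      show "case_prod F \<in> borel_measurable (lborel \<Otimes>\<^sub>M lborel)"
        unfolding F_def by measurable
      show "integrable lborel (\<lambda>s. \<integral>v. norm (case_prod F (s, v)) \<partial>lborel)"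
        by (simp add: F_def norm_mult)
      have "integrable lborel (\<lambda>v. iexp (c * s * v) * f v)" for s
        by (rule Bochner_Integration.integrable_bound[OF f]) (auto simp: norm_mult)
      then show "AE s in lborel. integrable lborel (\<lambda>v. case_prod F (s, v))"
        by (auto simp: F_def)
    qed
    note Fubini = lborel_pair.Fubini_integral[OF this]
    have inner: "(\<integral>s. F s v \<partial>lborel) = f v * of_real (exp (- (c * v)\<^sup>2 / 2))" for v
    proof -
      have "(\<integral>s. F s v \<partial>lborel) = (\<integral>s. f v * (?N s *\<^sub>R iexp (c * v * s)) \<partial>lborel)"
        by (simp add: F_def scaleR_conv_of_real mult_ac)
      also have "\<dots> = f v * (\<integral>s. ?N s *\<^sub>R iexp (c * v * s) \<partial>lborel)"
        by (rule integral_mult_right_zero)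
      also have "\<dots> = f v * char std_normal_distribution (c * v)"
        by (simp add: char_def integral_density)
      finally show ?thesis
        by (simp add: char_std_normal_distribution)
    qed
    have "(\<integral>s. of_real (?N s) * g (c * s) \<partial>lborel) = (\<integral>s. (\<integral>v. F s v \<partial>lborel) \<partial>lborel)"
      by (simp add: F_def g_def)
    also have "\<dots> = (\<integral>v. (\<integral>s. F s v \<partial>lborel) \<partial>lborel)"
      by (rule Fubini[symmetric])
    finally show ?thesis unfolding inner .
  qed
  \<comment> \<open>Substituting \<open>y = c * s\<close> on the left and \<open>u = c * v\<close>
    on the right gives Jacobians that cancel.\<close>
  have scaled: "(\<integral>y. of_real (?N (y / c)) * g y \<partial>lborel) =
      (\<integral>u. f (u / c) * of_real (exp (- u\<^sup>2 / 2)) \<partial>lborel)" if c: "c > 0" for c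
  proof -
    have "(\<integral>y. of_real (?N (y / c)) * g y \<partial>lborel) = c *\<^sub>R (\<integral>s. of_real (?N s) * g (c * s) \<partial>lborel)"
      using c by (subst lborel_integral_real_affine[where c = c and t = 0]) auto
    also have "\<dots> = (\<integral>u. f (u / c) * of_real (exp (- u\<^sup>2 / 2)) \<partial>lborel)"
      using c by (subst (2) lborel_integral_real_affine[where c = c and t = 0]) (auto simp: swap)
    finally show ?thesis .
  qed
  have N_le: "?N x \<le> ?N 0" for x by (simp add: std_normal_density_def divide_right_mono)
  have c_lim: "(\<lambda>n. y / real (Suc n)) \<longlonglongrightarrow> 0" for y
    by real_asymp
  have "(\<lambda>n. \<integral>y. of_real (?N (y / real (Suc n))) * g y \<partial>lborel) \<longlonglongrightarrow> (\<integral>y. of_real (?N 0) * g y \<partial>lborel)"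
  proof (rule integral_dominated_convergence[where w = "\<lambda>y. ?N 0 * norm (g y)"])
    show "AE y in lborel. (\<lambda>n. of_real (?N (y / real (Suc n))) * g y) \<longlonglongrightarrow> of_real (?N 0) * g y"
    proof (intro AE_I2 tendsto_intros)
      fix y
      have "isCont ?N 0" unfolding std_normal_density_def by (intro continuous_intros) auto
      then show "(\<lambda>n. ?N (y / real (Suc n))) \<longlonglongrightarrow> ?N 0"
        by (rule isCont_tendsto_compose[OF _ c_lim])
    qed
    show "AE y in lborel. norm (of_real (?N (y / real (Suc n))) * g y) \<le> ?N 0 * norm (g y)" for n
      by (intro AE_I2) (auto simp: norm_mult intro!: mult_right_mono N_le)
  qed (use g in auto)
  moreover have "(\<lambda>n. \<integral>u. f (u / real (Suc n)) * of_real (exp (- u\<^sup>2 / 2)) \<partial>lborel) \<longlonglongrightarrow>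
      (\<integral>u. f 0 * of_real (exp (- u\<^sup>2 / 2)) \<partial>lborel)"
  proof (rule integral_dominated_convergence[where w = "\<lambda>u. B * (sqrt (2 * pi) * ?N u)"])
    show "AE u in lborel. (\<lambda>n. f (u / real (Suc n)) * of_real (exp (- u\<^sup>2 / 2))) \<longlonglongrightarrow>
        f 0 * of_real (exp (- u\<^sup>2 / 2))"
      by (intro AE_I2 tendsto_intros isCont_tendsto_compose[OF cont c_lim])
    show "AE u in lborel. norm (f (u / real (Suc n)) * of_real (exp (- u\<^sup>2 / 2)))
        \<le> B * (sqrt (2 * pi) * ?N u)" for n
      by (intro AE_I2) (auto simp: norm_mult std_normal_density_def intro!: mult_right_mono bdd)
  qed auto
  moreover have "(\<integral>y. of_real (?N (y / real (Suc n))) * g y \<partial>lborel) =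
      (\<integral>u. f (u / real (Suc n)) * of_real (exp (- u\<^sup>2 / 2)) \<partial>lborel)" for n
    by (rule scaled) simp
  ultimately have "(\<integral>y. of_real (?N 0) * g y \<partial>lborel) = (\<integral>u. f 0 * of_real (exp (- u\<^sup>2 / 2)) \<partial>lborel)"
    by (simp only: LIMSEQ_unique)
  moreover have "(\<integral>u. f 0 * of_real (exp (- u\<^sup>2 / 2)) \<partial>lborel) =
      (\<integral>u. (f 0 * of_real (sqrt (2 * pi))) * of_real (?N u) \<partial>lborel)"
    by (simp add: std_normal_density_def)
  moreover have "\<dots> = f 0 * of_real (sqrt (2 * pi))"
    by simp
  ultimately have "of_real (?N 0) * (\<integral>y. g y \<partial>lborel) = f 0 * of_real (sqrt (2 * pi))"
    by simp
  \<comment> \<open>One factor \<open>sqrt (2 * pi)\<close> is \<open>1 / ?N 0\<close>, the other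
    the total mass of the unnormalised Gaussian.\<close>
  then have "(\<integral>y. g y \<partial>lborel) = f 0 * (of_real (sqrt (2 * pi)) * of_real (sqrt (2 * pi)))"
    by (simp add: std_normal_density_def field_simps)
  also have "of_real (sqrt (2 * pi)) * of_real (sqrt (2 * pi)) = (2 * of_real pi :: complex)"
    by (simp only: of_real_mult[symmetric]) simp
  finally show ?thesis by simp
qed

text \<open>With \<open>t = Complex a y\<close> the Mellin integral of the exponential is the
  Fourier transform at \<open>y\<close> of \<open>exp (a * v - w * exp v)\<close>, whose value at
  \<open>v = 0\<close> is \<open>exp (- w)\<close>.\<close>

lemma Mellin_inversion_exp:
  fixes a :: real and w :: complex
  assumes a: "a > 0" and w: "Re w > 0"
  shows "integrable lborel (\<lambda>y. w powr (- Complex a y) * Gamma (Complex a y))"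
    and "(\<integral>y. w powr (- Complex a y) * Gamma (Complex a y) \<partial>lborel) = 2 * of_real pi * exp (- w)"
proof -
  define f where "f = (\<lambda>v::real. exp (of_real a * of_real v - w * of_real (exp v)))"
  let ?g = "\<lambda>y. w powr (- Complex a y) * Gamma (Complex a y)"
  have w0: "w \<noteq> 0" using w by auto
  obtain h where h: "integrable lborel h"
    "\<And>u y. u \<noteq> 0 \<Longrightarrow> Re w / norm w * norm u \<le> Re u \<Longrightarrow>
          norm (u powr (- Complex a y) * Gamma (Complex a y)) \<le> norm u powr (- a) * h y"
    using powr_Gamma_vertical_bound[OF a, of "Re w / norm w"] w w0 by auto
  show g: "integrable lborel ?g"
  proof (rule Bochner_Integration.integrable_bound)
    show "integrable lborel (\<lambda>y. norm w powr (- a) * h y)" using h(1) by simp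
    show "AE y in lborel. norm (?g y) \<le> norm (norm w powr (- a) * h y)"
    proof (rule AE_I2)
      fix y
      show "norm (?g y) \<le> norm (norm w powr (- a) * h y)"
        using h(2)[of w y] w0 by simp
    qed
  qed (use measurable_powr_Gamma_vertical[OF a] in auto)
  have g_eq: "?g = (\<lambda>y. \<integral>v. iexp (y * v) * f v \<partial>lborel)"
  proof
    fix y
    have "iexp (y * v) * f v = exp (Complex a y * of_real v - w * of_real (exp v))" for v
      unfolding f_def mult_exp_exp by (rule arg_cong[of _ _ exp]) (simp add: complex_eq_iff)
    then show "?g y = (\<integral>v. iexp (y * v) * f v \<partial>lborel)"
      using Mellin_exp(2)[of "Complex a y" w] a w by simp
  qed
  \<comment> \<open>The exponent \<open>a * v - Re w * exp v\<close> is largest at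
    \<open>v = ln (a / Re w)\<close>.\<close>
  have "norm (f v) \<le> exp (a * ln (a / Re w) - a)" for v
  proof -
    have "a * v - Re w * exp v \<le> a * ln (a / Re w) - a"
    proof -
      have "ln (Re w * exp v / a) \<le> Re w * exp v / a - 1"
        using a w by (intro ln_le_minus_one) auto
      also have "ln (Re w * exp v / a) = v - ln (a / Re w)"
        using a w by (simp add: ln_mult ln_div)
      finally show ?thesis using a by (simp add: field_simps)
    qed
    then show ?thesis by (simp add: f_def)
  qed
  moreover have "integrable lborel f"
    using Mellin_exp(1)[of "of_real a" w] a w by (simp add: f_def)
  moreover have "isCont f 0" unfolding f_def by (intro continuous_intros)
  ultimately have "(\<integral>y. ?g y \<partial>lborel) = 2 * of_real pi * f 0"
    using Fourier_inversion_at_0[of f] g unfolding g_eq by blast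
  then show "(\<integral>y. ?g y \<partial>lborel) = 2 * of_real pi * exp (- w)"
    by (simp add: f_def)
qed

section \<open>Generating functions of the polynomials \<open>w_poly0\<close>\<close>

lemma fps_nth_power_mult_eq_0:
  fixes Y :: "'a::comm_ring_1 fps"
  assumes "fps_nth Y 0 = 0"
  shows "fps_nth (Y ^ Suc n * Z) n = 0"
proof -
  have "fps_nth (Y ^ Suc n) i = 0" if "i \<le> n" for i
    using startsby_zero_power_prefix[OF assms] that by (auto simp del: power_Suc)
  then show ?thesis
    by (simp add: fps_mult_nth del: power_Suc)
qed

text \<open>The weights \<open>\<beta> ^ k * fact k\<close> cancel the denominators in
  \<open>r_whitney2\<close>, leaving a truncated geometric series.\<close>

lemma w_poly0_eq_fps_nth:
  assumes "\<beta> \<noteq> 0"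
  shows "w_poly0 n \<beta> r X =
    fact n * fps_nth ((\<Sum>k\<le>n. (fps_const X * (fps_exp \<beta> - 1)) ^ k) * fps_exp r) n"
proof -
  define D where "D = (fps_exp \<beta> - 1) / fps_const \<beta>"
  \<comment> \<open>The quotient \<open>D\<close> is exact because \<open>fps_const \<beta>\<close>
    is a unit.\<close>
  have "fps_const \<beta> dvd fps_exp \<beta> - 1"
    by (rule unit_imp_dvd) (simp add: assms)
  then have D: "fps_exp \<beta> - 1 = fps_const \<beta> * D"
    unfolding D_def by (simp only: dvd_mult_div_cancel)
  have "fact n * fps_nth ((fps_const X * (fps_exp \<beta> - 1)) ^ k * fps_exp r) n =
      r_whitney2 \<beta> r n k * \<beta> ^ k * fact k * X ^ k" for k
  proof -
    have "(fps_const X * (fps_exp \<beta> - 1)) ^ k * fps_exp r =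
        fps_const (X ^ k * \<beta> ^ k) * (D ^ k * fps_exp r)"
      by (simp add: D power_mult_distrib fps_const_power mult_ac)
    then have "fps_nth ((fps_const X * (fps_exp \<beta> - 1)) ^ k * fps_exp r) n =
        X ^ k * \<beta> ^ k * fps_nth (D ^ k * fps_exp r) n"
      by (simp only: fps_mult_left_const_nth)
    then show ?thesis
      unfolding r_whitney2_def D_def[symmetric] by simp
  qed
  then show ?thesis
    by (simp add: w_poly0_def sum_distrib_right sum_distrib_left fps_sum_nth)
qed

text \<open>Formally the series is the sum of \<open>q ^ k * exp ((r + \<beta> * k) * t)\<close>;
  multiplying by \<open>q * exp (\<beta> * t)\<close> shifts \<open>k\<close> by one, so only the
  term \<open>k = 0\<close> survives. The rearrangement is justified coefficientwise.\<close>

lemma fps_geometric_exp_sum: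
  fixes q r \<beta> :: complex
  assumes sum: "\<And>m. summable (\<lambda>k. q ^ k * (r + \<beta> * of_nat k) ^ m)"
  shows "(1 - fps_const q * fps_exp \<beta>) *
      Abs_fps (\<lambda>m. (\<Sum>k. q ^ k * (r + \<beta> * of_nat k) ^ m) / fact m) = fps_exp r"
proof (rule fps_ext)
  fix m
  let ?a = "\<lambda>m k. q ^ k * (r + \<beta> * of_nat k) ^ m"
  define S where "S = Abs_fps (\<lambda>m. (\<Sum>k. ?a m k) / fact m)"
  note shifted = summable_Suc_iff[THEN iffD2, OF sum[of m]]
  \<comment> \<open>The binomial theorem, read off from the product of two exponential
    series.\<close>
  have binom: "(\<Sum>i=0..m. \<beta> ^ i / fact i * (c ^ (m - i) / fact (m - i))) = (\<beta> + c) ^ m / fact m"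
    for c :: complex
    using arg_cong[OF fps_exp_add_mult[of \<beta> c], of "\<lambda>F. fps_nth F m"]
    by (simp add: fps_mult_nth)
  have "fps_nth (fps_const q * fps_exp \<beta> * S) m =
      q * (\<Sum>i=0..m. \<beta> ^ i / fact i * ((\<Sum>k. ?a (m - i) k) / fact (m - i)))"
    unfolding mult.assoc[of "fps_const q"] fps_mult_left_const_nth by (simp add: S_def fps_mult_nth)
  also have "\<dots> = q * (\<Sum>i=0..m. \<Sum>k. \<beta> ^ i / fact i * (?a (m - i) k / fact (m - i)))"
    by (simp only: suminf_divide[OF sum] suminf_mult[OF summable_divide[OF sum]])
  also have "\<dots> = q * (\<Sum>k. \<Sum>i=0..m. \<beta> ^ i / fact i * (?a (m - i) k / fact (m - i)))"
    by (subst suminf_sum) (auto intro!: summable_mult summable_divide sum)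
  also have "(\<lambda>k. \<Sum>i=0..m. \<beta> ^ i / fact i * (?a (m - i) k / fact (m - i))) =
      (\<lambda>k. q ^ k * ((\<beta> + (r + \<beta> * of_nat k)) ^ m / fact m))"
    unfolding binom[symmetric] by (simp add: sum_distrib_left mult_ac)
  also have "\<dots> = (\<lambda>k. q ^ k * (r + \<beta> * of_nat (Suc k)) ^ m / fact m)"
    by (simp add: algebra_simps)
  also have "q * (\<Sum>k. q ^ k * (r + \<beta> * of_nat (Suc k)) ^ m / fact m) = (\<Sum>k. ?a m (Suc k) / fact m)"
  \<comment> \<open>Pulling \<open>q\<close> into the sum needs summability without that factor,
    obtained by dividing by \<open>q\<close>; for \<open>q = 0\<close> both sides vanish.\<close>
  proof (cases "q = 0")
    case False
    have "summable (\<lambda>k. ?a m (Suc k) / fact m / q)"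
      by (intro summable_divide shifted)
    then have "summable (\<lambda>k. q ^ k * (r + \<beta> * of_nat (Suc k)) ^ m / fact m)"
      using False by simp
    then show ?thesis by (simp add: suminf_mult[symmetric] mult.assoc)
  qed auto
  also have "\<dots> = (\<Sum>k. ?a m (Suc k)) / fact m"
    by (intro suminf_divide shifted)
  also have "\<dots> = fps_nth S m - r ^ m / fact m"
    using suminf_split_head[OF sum[of m]] by (simp add: S_def diff_divide_distrib)
  finally show "fps_nth ((1 - fps_const q * fps_exp \<beta>) * S) m = fps_nth (fps_exp r) m"
    by (simp add: left_diff_distrib)
qed

text \<open>For \<open>X = q / (1 - q)\<close> and \<open>Y = X * (exp (\<beta> * t) - 1)\<close>
  one has \<open>1 - q * exp (\<beta> * t) = (1 - q) * (1 - Y)\<close>. The geometric sum up to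
  \<open>Y ^ n\<close> inverts \<open>1 - Y\<close> up to a multiple of \<open>Y ^ Suc n\<close>,
  which cannot reach the coefficient of order \<open>n\<close> since \<open>Y\<close> has no
  constant term.\<close>

lemma w_poly0_eq_suminf:
  fixes q r \<beta> :: complex
  assumes \<beta>: "\<beta> \<noteq> 0" and q: "q \<noteq> 1"
    and sum: "\<And>m. summable (\<lambda>k. q ^ k * (r + \<beta> * of_nat k) ^ m)"
  shows "w_poly0 n \<beta> r (q / (1 - q)) = (1 - q) * (\<Sum>k. q ^ k * (r + \<beta> * of_nat k) ^ n)"
proof -
  define Y where "Y = fps_const (q / (1 - q)) * (fps_exp \<beta> - 1)"
  define S where "S = Abs_fps (\<lambda>m. (\<Sum>k. q ^ k * (r + \<beta> * of_nat k) ^ m) / fact m)"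
  have "fps_const (1 - q) * Y = fps_const q * (fps_exp \<beta> - 1)"
    using q by (simp add: Y_def mult.assoc[symmetric])
  then have "1 - fps_const q * fps_exp \<beta> = fps_const (1 - q) * (1 - Y)"
    by (simp add: algebra_simps flip: fps_const_sub)
  then have "fps_exp r = (1 - Y) * (fps_const (1 - q) * S)"
    using fps_geometric_exp_sum[OF sum] by (simp add: S_def mult_ac)
  then have "(\<Sum>k\<le>n. Y ^ k) * fps_exp r = ((1 - Y) * (\<Sum>k\<le>n. Y ^ k)) * (fps_const (1 - q) * S)"
    by (simp add: mult_ac)
  also have "\<dots> = fps_const (1 - q) * S - Y ^ Suc n * (fps_const (1 - q) * S)"
    unfolding sum_gp_basic by (simp add: left_diff_distrib)
  finally have "fps_nth ((\<Sum>k\<le>n. Y ^ k) * fps_exp r) n = (1 - q) * fps_nth S n"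
    using fps_nth_power_mult_eq_0[of Y n "fps_const (1 - q) * S"] by (simp add: Y_def del: power_Suc)
  then show ?thesis
    using w_poly0_eq_fps_nth[OF \<beta>, of n r "q / (1 - q)"] by (simp add: Y_def S_def)
qed

section \<open>The Hurwitz zeta series and its termwise integration\<close>

lemma summable_norm_add_of_nat_powr:
  fixes c :: complex
  assumes "s < - 1"
  shows "summable (\<lambda>k. norm (of_nat k + c) powr s)"
proof (rule summable_comparison_test_ev)
  show "summable (\<lambda>k. (1 / 2) powr s * real k powr s)"
    using assms by (intro summable_mult) (simp add: summable_real_powr_iff)
  \<comment> \<open>From here on \<open>k + c\<close> has norm at least \<open>k / 2\<close>, and
    \<open>k\<close> is positive.\<close>
  have "eventually (\<lambda>k. real k \<ge> 2 * norm c + 1) sequentially"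
    by real_asymp
  then show "eventually (\<lambda>k. norm (norm (of_nat k + c) powr s) \<le> (1 / 2) powr s * real k powr s) sequentially"
  proof eventually_elim
    case (elim k)
    have k: "real k > 0" using elim norm_ge_zero[of c] by linarith
    have "real k - norm c \<le> norm (of_nat k + c)"
      using norm_diff_ineq[of "of_nat k" c] by simp
    then have "1 / 2 * real k \<le> norm (of_nat k + c)"
      using elim by linarith
    then have "norm (of_nat k + c) powr s \<le> (1 / 2 * real k) powr s"
      using k assms by (intro powr_mono2') auto
    also have "\<dots> = (1 / 2) powr s * real k powr s"
      by (rule powr_mult)
    finally show ?case by simp
  qed
qed

text \<open>Both arguments lie strictly within pi/2 of 0, so their difference stays in the principal
  range and the logarithms subtract without a correction.\<close>

lemma powr_divide_right_halfplane:
  assumes "Re z > 0" "Re b > 0"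
  shows "(z / b) powr s = z powr s / b powr s"
proof -
  have nz: "z \<noteq> 0" "b \<noteq> 0" using assms by auto
  have "z / b = exp (Ln z - Ln b)" using nz by (simp add: exp_diff)
  also have "Ln \<dots> = Ln z - Ln b"
    using Re_Ln_pos_lt_imp[OF assms(1)] Re_Ln_pos_lt_imp[OF assms(2)] by (intro Ln_exp) auto
  finally show ?thesis
    using nz by (simp add: powr_def exp_diff right_diff_distrib)
qed

text \<open>The lower bound \<open>\<delta> * norm w \<le> Re w\<close> defines a cone, so it is inherited by all
  points \<open>r + \<beta> k\<close> from \<open>r\<close> and \<open>\<beta>\<close>; this makes the decay of the integrands uniform in \<open>k\<close>.\<close>
lemma hurwitz_zeta_Mellin:
  fixes x a :: real and \<beta> r :: complex and n :: nat
  assumes x: "x > 0" and \<beta>: "Re \<beta> > 0" and r: "Re r > 0" and a: "a > real n + 1"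
  defines "G \<equiv> \<lambda>y. (\<beta> * of_real x) powr (- Complex a y) *
    hurwitz_zeta (Complex a y - of_nat n) (r / \<beta>) * Gamma (Complex a y)"
  shows "integrable lborel G"
    and "(\<lambda>k. (of_nat k + r / \<beta>) ^ n * (2 * of_real pi * exp (- (of_real x * (r + \<beta> * of_nat k)))))
           sums (\<integral>y. G y \<partial>lborel)"
proof -
  define c where "c = r / \<beta>"
  define z where "z = (\<lambda>k::nat. of_real x * (r + \<beta> * of_nat k))"
  define g where "g = (\<lambda>k y. (of_nat k + c) ^ n * (z k powr (- Complex a y) * Gamma (Complex a y)))"
  define \<delta> where "\<delta> = min (Re \<beta> / norm \<beta>) (Re r / norm r)"
  have nz: "\<beta> \<noteq> 0" "r \<noteq> 0" using \<beta> r by auto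
  have a0: "a > 0" using a by linarith
  have \<delta>: "\<delta> > 0" using \<beta> r nz by (simp add: \<delta>_def)
  have z_eq: "z k = (\<beta> * of_real x) * (of_nat k + c)" for k
    using nz by (simp add: z_def c_def field_simps)
  have Re_z: "Re (z k) > 0" for k
    using x \<beta> r by (simp add: z_def add_pos_nonneg)
  then have z0: "z k \<noteq> 0" for k by (metis less_irrefl zero_complex.simps(1))
  then have kc: "of_nat k + c \<noteq> 0" for k by (metis z_eq mult_zero_right)
  have cone: "\<delta> * norm (z k) \<le> Re (z k)" for k
  proof -
    have "\<delta> * norm \<beta> \<le> Re \<beta>" "\<delta> * norm r \<le> Re r"
      using nz by (simp_all add: \<delta>_def min_def field_simps)
    then have "\<delta> * norm r + \<delta> * norm \<beta> * real k \<le> Re r + Re \<beta> * real k"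
      by (intro add_mono mult_right_mono) auto
    moreover have "\<delta> * norm (r + \<beta> * of_nat k) \<le> \<delta> * (norm r + norm \<beta> * real k)"
      using \<delta> norm_triangle_ineq[of r "\<beta> * of_nat k"] by (intro mult_left_mono) (auto simp: norm_mult)
    ultimately have "\<delta> * norm (r + \<beta> * of_nat k) \<le> Re (r + \<beta> * of_nat k)"
      by (simp add: algebra_simps)
    then have "x * (\<delta> * norm (r + \<beta> * of_nat k)) \<le> x * Re (r + \<beta> * of_nat k)"
      using x by (intro mult_left_mono) auto
    then show ?thesis using x by (simp add: z_def norm_mult mult_ac)
  qed
  obtain h where h: "integrable lborel h"
    "\<And>w y. w \<noteq> 0 \<Longrightarrow> \<delta> * norm w \<le> Re w \<Longrightarrow>
          norm (w powr (- Complex a y) * Gamma (Complex a y)) \<le> norm w powr (- a) * h y"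
    using powr_Gamma_vertical_bound[OF a0 \<delta>] by blast
  \<comment> \<open>The exponent \<open>real n - a\<close> is below -1 exactly because
    \<open>a > real n + 1\<close>.\<close>
  define b where "b = (\<lambda>k. norm (\<beta> * of_real x) powr (- a) * norm (of_nat k + c) powr (real n - a))"
  have b_summable: "summable b"
    unfolding b_def using a by (intro summable_mult summable_norm_add_of_nat_powr) auto
  have g_le: "norm (g k y) \<le> b k * h y" for k y
  proof -
    have "norm (g k y) \<le> norm (of_nat k + c) ^ n * (norm (z k) powr (- a) * h y)"
      unfolding g_def norm_mult[of "_ ^ n"] norm_power
      by (intro mult_left_mono h z0 cone) auto
    also have "norm (z k) powr (- a) = norm (\<beta> * of_real x) powr (- a) * norm (of_nat k + c) powr (- a)"
      unfolding z_eq norm_mult[of "\<beta> * of_real x"] by (rule powr_mult)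
    also have "norm (of_nat k + c) ^ n = norm (of_nat k + c) powr real n"
      using kc[of k] by (simp add: powr_realpow)
    finally show ?thesis by (simp add: b_def powr_diff powr_minus field_simps)
  qed
  have int: "integrable lborel (g k)" for k
    unfolding g_def by (intro integrable_mult_right Mellin_inversion_exp a0 Re_z)
  have sum1: "AE y in lborel. summable (\<lambda>k. norm (g k y))"
    by (intro AE_I2 summable_comparison_test'[OF summable_mult2[OF b_summable]]) (use g_le in auto)
  have sum2: "summable (\<lambda>k. \<integral>y. norm (g k y) \<partial>lborel)"
  proof (rule summable_comparison_test'[OF summable_mult2[OF b_summable]])
    fix k
    have "(\<integral>y. norm (g k y) \<partial>lborel) \<le> (\<integral>y. b k * h y \<partial>lborel)"
      using h(1) int by (intro integral_mono g_le) auto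
    then show "norm (\<integral>y. norm (g k y) \<partial>lborel) \<le> b k * (\<integral>y. h y \<partial>lborel)"
      by simp
  qed
  have "(\<Sum>k. g k y) = G y" for y
  proof -
    define t where "t = Complex a y"
    have Re\<beta>x: "Re (\<beta> * of_real x) > 0" using x \<beta> by simp
    have \<beta>x: "\<beta> * of_real x \<noteq> 0" using nz x by simp
    \<comment> \<open>The point \<open>k + c\<close> may leave the right half-plane, but it is a
      quotient of \<open>z k\<close> and \<open>\<beta> * x\<close>, which both lie in it.\<close>
    have "(of_nat k + c) powr (- (t - of_nat n)) =
        (of_nat k + c) ^ n * (z k powr (- t) / (\<beta> * of_real x) powr (- t))" for k
    proof -
      have "of_nat k + c = z k / (\<beta> * of_real x)"
        using \<beta>x by (simp add: z_eq)
      then have "(of_nat k + c) powr (- t) = z k powr (- t) / (\<beta> * of_real x) powr (- t)"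
        using powr_divide_right_halfplane[OF Re_z Re\<beta>x] by metis
      moreover have "(of_nat k + c) powr (- (t - of_nat n)) = (of_nat k + c) ^ n * (of_nat k + c) powr (- t)"
        using kc[of k] by (simp add: powr_diff powr_minus divide_simps)
      ultimately show ?thesis by simp
    qed
    then have g_eq: "g k y = (\<beta> * of_real x) powr (- t) * Gamma t * (of_nat k + c) powr (- (t - of_nat n))" for k
      using \<beta>x by (simp add: g_def t_def)
    \<comment> \<open>A nonzero \<open>Gamma t\<close> can be divided out, which turns summability
      of \<open>g k y\<close> into convergence of the zeta series.\<close>
    have "t \<notin> \<int>\<^sub>\<le>\<^sub>0"
      using a0 by (auto simp: t_def complex_eq_iff elim!: nonpos_Ints_cases)
    then have "Gamma t \<noteq> 0"
      by (simp add: Gamma_eq_zero_iff)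
    moreover have "summable (\<lambda>k. g k y)"
      by (rule summable_comparison_test'[OF summable_mult2[OF b_summable]]) (use g_le in auto)
    ultimately have "summable (\<lambda>k. (of_nat k + c) powr (- (t - of_nat n)))"
      unfolding g_eq using \<beta>x by (subst (asm) summable_cmult_iff) auto
    from suminf_mult[OF this, of "(\<beta> * of_real x) powr (- t) * Gamma t"] show ?thesis
      unfolding g_eq G_def hurwitz_zeta_def c_def[symmetric] t_def[symmetric]
      by (simp only: mult_ac)
  qed
  then have G: "(\<lambda>y. \<Sum>k. g k y) = G" by auto
  show "integrable lborel G"
    using integrable_suminf[OF int sum1 sum2] unfolding G .
  have "(\<integral>y. g k y \<partial>lborel) = (of_nat k + r / \<beta>) ^ n * (2 * of_real pi * exp (- (of_real x * (r + \<beta> * of_nat k))))" for k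
    using Mellin_inversion_exp(2)[OF a0 Re_z[of k]] by (simp add: g_def c_def z_def)
  then show "(\<lambda>k. (of_nat k + r / \<beta>) ^ n * (2 * of_real pi * exp (- (of_real x * (r + \<beta> * of_nat k)))))
           sums (\<integral>y. G y \<partial>lborel)"
    using sums_integral[OF int sum1 sum2] unfolding G by simp
qed

theorem proposition11:
  fixes x a :: real and \<beta> r :: complex and n :: nat
  assumes "x > 0" and "Re \<beta> > 0" and "Re r > 0" and "a > real n + 1"
  shows "vertical_integrable a
           (\<lambda>t. (\<beta> * of_real x) powr (- t) * hurwitz_zeta (t - of_nat n) (r / \<beta>) * Gamma t) \<and>
         exp (- r * of_real x) / (1 - exp (- \<beta> * of_real x)) *
           w_poly0 n \<beta> r (exp (- \<beta> * of_real x) / (1 - exp (- \<beta> * of_real x))) =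
         \<beta> ^ n / (2 * of_real pi * \<i>) *
           vertical_integral a
             (\<lambda>t. (\<beta> * of_real x) powr (- t) * hurwitz_zeta (t - of_nat n) (r / \<beta>) * Gamma t)"
proof -
  define q where "q = exp (- \<beta> * of_real x)"
  define E where "E = exp (- r * of_real x)"
  define G where "G = (\<lambda>y. (\<beta> * of_real x) powr (- Complex a y) *
    hurwitz_zeta (Complex a y - of_nat n) (r / \<beta>) * Gamma (Complex a y))"
  have \<beta>: "\<beta> \<noteq> 0" using assms by auto
  have "norm q < 1" using assms by (simp add: q_def)
  then have q: "q \<noteq> 1" by auto
  have G: "integrable lborel G"
    unfolding G_def by (rule hurwitz_zeta_Mellin assms)+
  have terms: "(of_nat k + r / \<beta>) ^ m * (2 * of_real pi * exp (- (of_real x * (r + \<beta> * of_nat k)))) =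
      (2 * of_real pi * E / \<beta> ^ m) * (q ^ k * (r + \<beta> * of_nat k) ^ m)" for k m
  proof -
    have "exp (- (of_real x * (r + \<beta> * of_nat k))) = E * q ^ k"
      unfolding E_def q_def exp_of_nat_mult[symmetric] mult_exp_exp by (simp add: algebra_simps)
    moreover have "of_nat k + r / \<beta> = (r + \<beta> * of_nat k) / \<beta>"
      using \<beta> by (simp add: field_simps)
    ultimately show ?thesis by (simp add: power_divide)
  qed
  have sum: "summable (\<lambda>k. q ^ k * (r + \<beta> * of_nat k) ^ m)" for m
  proof -
    have "summable (\<lambda>k. (2 * of_real pi * E / \<beta> ^ m) * (q ^ k * (r + \<beta> * of_nat k) ^ m))"
      \<comment> \<open>The generating function needs every power \<open>m\<close>, so each gets its
        own line of integration, at \<open>m + 2\<close>.\<close>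
      using hurwitz_zeta_Mellin(2)[OF assms(1-3), of m "real m + 2"]
      unfolding terms by (simp add: sums_iff)
    then show ?thesis
      using \<beta> by (subst (asm) summable_cmult_iff) (simp add: E_def)
  qed
  have "(\<integral>y. G y \<partial>lborel) = (2 * of_real pi * E / \<beta> ^ n) * (\<Sum>k. q ^ k * (r + \<beta> * of_nat k) ^ n)"
    using hurwitz_zeta_Mellin(2)[OF assms] sums_mult[OF summable_sums[OF sum]]
    unfolding terms G_def[symmetric] by (rule sums_unique2)
  moreover have "w_poly0 n \<beta> r (q / (1 - q)) = (1 - q) * (\<Sum>k. q ^ k * (r + \<beta> * of_nat k) ^ n)"
    by (rule w_poly0_eq_suminf[OF \<beta> q sum])
  ultimately have "E / (1 - q) * w_poly0 n \<beta> r (q / (1 - q)) =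
      \<beta> ^ n / (2 * of_real pi * \<i>) * ((\<integral>y. G y \<partial>lborel) * \<i>)"
    using \<beta> q by (simp add: mult.commute[of _ \<i>])
  \<comment> \<open>The Lebesgue integral agrees with the Henstock-Kurzweil one, and the factor from
    \<open>dt = \<i> dy\<close> cancels the one in \<open>2 * pi * \<i>\<close>.\<close>
  moreover have "((\<lambda>y. G y * \<i>) has_integral (\<integral>y. G y \<partial>lborel) * \<i>) UNIV"
    using has_integral_integral_lborel[of "\<lambda>y. G y * \<i>"] G by simp
  then have "vertical_integrable a
      (\<lambda>t. (\<beta> * of_real x) powr (- t) * hurwitz_zeta (t - of_nat n) (r / \<beta>) * Gamma t)"
    and "vertical_integral a
      (\<lambda>t. (\<beta> * of_real x) powr (- t) * hurwitz_zeta (t - of_nat n) (r / \<beta>) * Gamma t) =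
      (\<integral>y. G y \<partial>lborel) * \<i>"
    unfolding vertical_integrable_def vertical_integral_def G_def
    by (rule has_integral_integrable, rule integral_unique)
  ultimately show ?thesis
    unfolding q_def E_def by simp
qed

end
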